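(* Let $R$ be a commutative ring and $M$ a nonzero Noetherian $R$-module. (1) Let $p$ be a prime ideal of $R$. Then $M$ is $p$-secondary (resp. $p$-second) if and only if every nonzero submodule of $M$ is $p$-secondary (resp. $p$-second). (2) If $M=\sum_{i=1}^nK_i$ is a minimal secondary representation, where $K_i$ is $p_i$-secondary for prime ideals $p_1,\dots,p_n$ of $R$, then $M=\bigoplus_{i=1}^nK_i$.
   Context: Let $R$ be a commutative ring. For an $R$-module $N$, $Ann(N)=\{r\in R\mid rN=0\}$. A nonzero $R$-module $N$ is secondary if for every $a\in R$ we have $aN=N$ or $a^nN=0$ for some $n\in\mathbb{N}$; then $p:=\sqrt{Ann(N)}$ is a prime ideal and $N$ is called $p$-secondary. A nonzero $R$-module $N$ is second if for every ideal $I\le R$ we have $IN=N$ or $IN=0$; then $p:=Ann(N)$ is a prime ideal and $N$ is called $p$-second. A secondary representation $M=\sum_{i=1}^nK_i$ of $M$ is an expression of $M$ as a finite sum of secondary submodules; it is minimal if $\sqrt{Ann(K_i)}\neq\sqrt{Ann(K_j)}$ whenever $i\neq j$ and $K_j\nsubseteq\sum_{i\neq j}K_i$ for all $j\in\{1,\dots,n\}$. *)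

theory Defs
  imports "HOL-Algebra.Module" "HOL-Algebra.Ideal"
begin

text \<open>A submodule K of M, regarded as a module in its own right, is the record
  \<open>M\<lparr>carrier := K\<rparr>\<close> (lemma \<open>submodule.submodule_is_module\<close>). All notions for modules
  below are applied to submodules in this way.\<close>

definition nonzero_module :: "('a, 'b, 'm) module_scheme \<Rightarrow> bool" where
  "nonzero_module N \<longleftrightarrow> carrier N \<noteq> {\<zero>\<^bsub>N\<^esub>}"

locale noetherian_module = module +
  assumes acc: "\<lbrakk>\<And>i::nat. submodule (N i) R M; \<And>i. N i \<subseteq> N (Suc i)\<rbrakk>
    \<Longrightarrow> \<exists>n. \<forall>m\<ge>n. N m = N n"

text \<open>The set aN.\<close>

definition elem_mult :: "'a \<Rightarrow> ('a, 'b, 'm) module_scheme \<Rightarrow> 'b set" where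
  "elem_mult a N = (\<lambda>x. a \<odot>\<^bsub>N\<^esub> x) ` carrier N"

text \<open>The submodule IN: all finite sums of products ax with a in I and x in N.\<close>

definition ideal_mult :: "'a set \<Rightarrow> ('a, 'b, 'm) module_scheme \<Rightarrow> 'b set" where
  "ideal_mult I N =
    {(\<Oplus>\<^bsub>N\<^esub> j \<in> {..<k::nat}. a j \<odot>\<^bsub>N\<^esub> x j) | k a x.
       a \<in> {..<k} \<rightarrow> I \<and> x \<in> {..<k} \<rightarrow> carrier N}"

definition annihilator :: "('a, 'r) ring_scheme \<Rightarrow> ('a, 'b, 'm) module_scheme \<Rightarrow> 'a set" where
  "annihilator R N = {r \<in> carrier R. elem_mult r N = {\<zero>\<^bsub>N\<^esub>}}"

text \<open>Allowing the exponent 0 here and in \<open>secondary\<close> below changes nothing: the unit lies in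
  the ideal I only if I is the whole ring, and 1N = N is not 0 for nonzero N.\<close>

definition radical :: "('a, 'r) ring_scheme \<Rightarrow> 'a set \<Rightarrow> 'a set" where
  "radical R I = {r \<in> carrier R. \<exists>n::nat. r [^]\<^bsub>R\<^esub> n \<in> I}"

definition secondary :: "('a, 'r) ring_scheme \<Rightarrow> ('a, 'b, 'm) module_scheme \<Rightarrow> bool" where
  "secondary R N \<longleftrightarrow> module R N \<and> nonzero_module N \<and>
    (\<forall>a \<in> carrier R. elem_mult a N = carrier N \<or>
       (\<exists>n::nat. elem_mult (a [^]\<^bsub>R\<^esub> n) N = {\<zero>\<^bsub>N\<^esub>}))"

definition p_secondary ::
  "('a, 'r) ring_scheme \<Rightarrow> 'a set \<Rightarrow> ('a, 'b, 'm) module_scheme \<Rightarrow> bool" where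
  "p_secondary R p N \<longleftrightarrow> secondary R N \<and> p = radical R (annihilator R N)"

definition second :: "('a, 'r) ring_scheme \<Rightarrow> ('a, 'b, 'm) module_scheme \<Rightarrow> bool" where
  "second R N \<longleftrightarrow> module R N \<and> nonzero_module N \<and>
    (\<forall>I. ideal I R \<longrightarrow> ideal_mult I N = carrier N \<or> ideal_mult I N = {\<zero>\<^bsub>N\<^esub>})"

definition p_second ::
  "('a, 'r) ring_scheme \<Rightarrow> 'a set \<Rightarrow> ('a, 'b, 'm) module_scheme \<Rightarrow> bool" where
  "p_second R p N \<longleftrightarrow> second R N \<and> p = annihilator R N"

text \<open>The sum of the submodules K i for i in a finite set J; it is the zero submodule
  when J is empty.\<close>

definition submodule_sum :: "('a, 'b, 'm) module_scheme \<Rightarrow> ('i \<Rightarrow> 'b set) \<Rightarrow> 'i set \<Rightarrow> 'b set" where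
  "submodule_sum M K J = {(\<Oplus>\<^bsub>M\<^esub> i \<in> J. x i) | x. \<forall>i\<in>J. x i \<in> K i}"

definition secondary_representation ::
  "('a, 'r) ring_scheme \<Rightarrow> ('a, 'b, 'm) module_scheme \<Rightarrow> nat \<Rightarrow> (nat \<Rightarrow> 'b set) \<Rightarrow> bool" where
  "secondary_representation R M n K \<longleftrightarrow>
    (\<forall>i\<in>{1..n}. submodule (K i) R M \<and> secondary R (M\<lparr>carrier := K i\<rparr>)) \<and>
    carrier M = submodule_sum M K {1..n}"

definition minimal_secondary_representation ::
  "('a, 'r) ring_scheme \<Rightarrow> ('a, 'b, 'm) module_scheme \<Rightarrow> nat \<Rightarrow> (nat \<Rightarrow> 'b set) \<Rightarrow> bool" where
  "minimal_secondary_representation R M n K \<longleftrightarrow>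
    secondary_representation R M n K \<and>
    (\<forall>i\<in>{1..n}. \<forall>j\<in>{1..n}. i \<noteq> j \<longrightarrow>
       radical R (annihilator R (M\<lparr>carrier := K i\<rparr>))
         \<noteq> radical R (annihilator R (M\<lparr>carrier := K j\<rparr>))) \<and>
    (\<forall>j\<in>{1..n}. \<not> K j \<subseteq> submodule_sum M K ({1..n} - {j}))"

text \<open>M is the internal direct sum of the submodules K i for i in a finite set J: every
  element of M is a sum of elements x i of K i for exactly one family x. The extensional
  function space identifies families that agree on J.\<close>

definition is_direct_sum ::
  "('a, 'r) ring_scheme \<Rightarrow> ('a, 'b, 'm) module_scheme \<Rightarrow> ('i \<Rightarrow> 'b set) \<Rightarrow> 'i set \<Rightarrow> bool" where
  "is_direct_sum R M K J \<longleftrightarrow>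
    (\<forall>i\<in>J. submodule (K i) R M) \<and>
    submodule_sum M K J = carrier M \<and>
    (\<forall>m \<in> carrier M. \<exists>!x. x \<in> (\<Pi>\<^sub>E i\<in>J. K i) \<and> m = (\<Oplus>\<^bsub>M\<^esub> i \<in> J. x i))"

end

theory Submission
  imports Defs
begin

text \<open>
  Everything rests on one consequence of the ascending chain condition. Suppose that a ring
  element \<open>a\<close> maps a submodule \<open>K\<close> of the Noetherian module \<open>M\<close> onto itself, and let \<open>L\<close> be
  any submodule. The submodules \<open>{x \<in> K. a\<^sup>k x \<in> L}\<close> grow with \<open>k\<close>, so they stabilise at some
  exponent \<open>n\<close>. Writing an element \<open>y\<close> of \<open>K\<close> with \<open>a y \<in> L\<close> as \<open>y = a\<^sup>n x\<close>, one gets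
  \<open>a\<^sup>n\<^sup>+\<^sup>1 x \<in> L\<close>, hence already \<open>y = a\<^sup>n x \<in> L\<close>
  (lemma \<open>noetherian_module.mem_if_smult_mem\<close>).

  With \<open>K = M\<close> this says that an \<open>a\<close> acting surjectively on \<open>M\<close> acts surjectively on every
  submodule of \<open>M\<close>. Being secondary is a dichotomy, for single ring elements, between acting
  surjectively and acting nilpotently; being second is the same dichotomy with zero in place of
  nilpotent (lemma \<open>module.second_iff_elem_mult\<close>). Both alternatives pass to submodules, and on a
  nonzero submodule they still exclude each other, so that the prime does not change either. The
  converse is trivial because \<open>M\<close> is one of its own submodules.

  With \<open>L = 0\<close> it says that an \<open>a\<close> acting surjectively on \<open>K\<close> acts injectively on \<open>K\<close>. Now let
  \<open>K i\<close> be secondary submodules with different primes and let \<open>x i \<in> K i\<close> be a family with sum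
  zero. For two indices \<open>i\<close>, \<open>j\<close> some power \<open>b\<close> of a ring element kills \<open>K i\<close> and acts
  injectively on \<open>K j\<close>, or vice versa. Multiplying the relation by \<open>b\<close> removes the term at \<open>i\<close>;
  by induction on the set of indices all \<open>b x k\<close> vanish, in particular \<open>b x j\<close>, and so \<open>x j\<close>.
  What is left is a relation without the term at \<open>j\<close>, and the induction applies again
  (lemma \<open>noetherian_module.secondary_independent\<close>).
\<close>


section \<open>Multiplication by a ring element\<close>

lemma (in module) elem_mult_eq_zero_iff:
  "elem_mult a M = {\<zero>\<^bsub>M\<^esub>} \<longleftrightarrow> (\<forall>x\<in>carrier M. a \<odot>\<^bsub>M\<^esub> x = \<zero>\<^bsub>M\<^esub>)"
  unfolding elem_mult_def by (auto simp: image_iff intro!: exI[of _ "\<zero>\<^bsub>M\<^esub>"])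

lemma (in module) elem_mult_pow:
  assumes a: "a \<in> carrier R" and onto: "elem_mult a M = carrier M"
  shows "elem_mult (a [^] (k::nat)) M = carrier M"
proof (induction k)
  case 0
  show ?case by (simp add: elem_mult_def)
next
  case (Suc k)
  have "elem_mult (a [^] Suc k) M = (\<lambda>x. a [^] k \<odot>\<^bsub>M\<^esub> x) ` elem_mult a M"
    unfolding elem_mult_def image_image
    using a by (intro image_cong) (simp_all add: smult_assoc1)
  then show ?case
    using Suc onto by (simp add: elem_mult_def)
qed

lemma radical_annihilator_iff:
  assumes "cring R"
  shows "a \<in> radical R (annihilator R N) \<longleftrightarrow>
    a \<in> carrier R \<and> (\<exists>n::nat. elem_mult (a [^]\<^bsub>R\<^esub> n) N = {\<zero>\<^bsub>N\<^esub>})"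
proof -
  interpret cring R by fact
  show ?thesis unfolding radical_def annihilator_def by auto
qed


section \<open>Second modules\<close>

lemma (in module) elem_mult_subset_ideal_mult:
  assumes I: "ideal I R" and a: "a \<in> I"
  shows "elem_mult a M \<subseteq> ideal_mult I M"
proof
  fix y assume "y \<in> elem_mult a M"
  then obtain x where x: "x \<in> carrier M" and y: "y = a \<odot>\<^bsub>M\<^esub> x"
    unfolding elem_mult_def by blast
  have "a \<in> carrier R" using I a by (rule ideal.Icarr)
  then have "y = (\<Oplus>\<^bsub>M\<^esub> j \<in> {..<1::nat}. a \<odot>\<^bsub>M\<^esub> x)"
    using x y by (simp add: lessThan_Suc)
  then show "y \<in> ideal_mult I M"
    unfolding ideal_mult_def using a x
    by (intro CollectI exI[of _ "1::nat"] exI[of _ "\<lambda>_. a"] exI[of _ "\<lambda>_. x"]) auto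
qed

lemma (in module) ideal_mult_subset_carrier:
  assumes I: "ideal I R"
  shows "ideal_mult I M \<subseteq> carrier M"
proof -
  have "I \<subseteq> carrier R" using ideal.Icarr[OF I] by blast
  then show ?thesis
    unfolding ideal_mult_def by (fastforce intro!: M.finsum_closed simp: Pi_iff)
qed

lemma (in module) ideal_mult_eq_zero_iff:
  assumes I: "ideal I R"
  shows "ideal_mult I M = {\<zero>\<^bsub>M\<^esub>} \<longleftrightarrow> (\<forall>a\<in>I. elem_mult a M = {\<zero>\<^bsub>M\<^esub>})"
proof
  assume zero: "ideal_mult I M = {\<zero>\<^bsub>M\<^esub>}"
  show "\<forall>a\<in>I. elem_mult a M = {\<zero>\<^bsub>M\<^esub>}"
  proof
    fix a assume "a \<in> I"
    then have "elem_mult a M \<subseteq> {\<zero>\<^bsub>M\<^esub>}"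
      using elem_mult_subset_ideal_mult[OF I] zero by simp
    then show "elem_mult a M = {\<zero>\<^bsub>M\<^esub>}"
      unfolding elem_mult_eq_zero_iff by (auto simp: elem_mult_def)
  qed
next
  assume zero: "\<forall>a\<in>I. elem_mult a M = {\<zero>\<^bsub>M\<^esub>}"
  have "\<zero>\<^bsub>R\<^esub> \<in> I"
    using I by (simp add: ideal_def additive_subgroup.zero_closed)
  then have "elem_mult \<zero>\<^bsub>R\<^esub> M \<subseteq> ideal_mult I M"
    by (rule elem_mult_subset_ideal_mult[OF I])
  then have "\<zero>\<^bsub>M\<^esub> \<in> ideal_mult I M"
    using zero \<open>\<zero>\<^bsub>R\<^esub> \<in> I\<close> by simp
  moreover have "(\<Oplus>\<^bsub>M\<^esub> j \<in> {..<k::nat}. a j \<odot>\<^bsub>M\<^esub> x j) = \<zero>\<^bsub>M\<^esub>"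
    if "a \<in> {..<k} \<rightarrow> I" "x \<in> {..<k} \<rightarrow> carrier M" for k a x
  proof -
    have "a j \<odot>\<^bsub>M\<^esub> x j = \<zero>\<^bsub>M\<^esub>" if "j \<in> {..<k}" for j
    proof -
      have "a j \<in> I" "x j \<in> carrier M"
        using \<open>a \<in> {..<k} \<rightarrow> I\<close> \<open>x \<in> {..<k} \<rightarrow> carrier M\<close> that by auto
      then show ?thesis using zero elem_mult_eq_zero_iff by blast
    qed
    then show ?thesis by (rule M.add.finprod_one_eqI)
  qed
  ultimately show "ideal_mult I M = {\<zero>\<^bsub>M\<^esub>}"
    unfolding ideal_mult_def by blast
qed

lemma (in module) ideal_mult_cgenideal:
  assumes a: "a \<in> carrier R"
  shows "ideal_mult (PIdl a) M = elem_mult a M"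
proof
  show "elem_mult a M \<subseteq> ideal_mult (PIdl a) M"
    using a by (intro elem_mult_subset_ideal_mult cgenideal_ideal cgenideal_self)
  show "ideal_mult (PIdl a) M \<subseteq> elem_mult a M"
  proof
    fix y assume "y \<in> ideal_mult (PIdl a) M"
    then obtain k :: nat and b x where b: "b \<in> {..<k} \<rightarrow> PIdl a"
      and x: "x \<in> {..<k} \<rightarrow> carrier M" and y: "y = (\<Oplus>\<^bsub>M\<^esub> j \<in> {..<k}. b j \<odot>\<^bsub>M\<^esub> x j)"
      unfolding ideal_mult_def by blast
    have "\<exists>c. \<forall>j\<in>{..<k}. c j \<in> carrier R \<and> b j = c j \<otimes> a"
      using b unfolding cgenideal_def by (intro bchoice) blast
    then obtain c where c: "\<And>j. j \<in> {..<k} \<Longrightarrow> c j \<in> carrier R"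
      and bc: "\<And>j. j \<in> {..<k} \<Longrightarrow> b j = c j \<otimes> a" by blast
    have cx: "(\<lambda>j. c j \<odot>\<^bsub>M\<^esub> x j) \<in> {..<k} \<rightarrow> carrier M" using c x by auto
    have "y = (\<Oplus>\<^bsub>M\<^esub> j \<in> {..<k}. a \<odot>\<^bsub>M\<^esub> (c j \<odot>\<^bsub>M\<^esub> x j))"
      unfolding y
    proof (rule M.finsum_cong')
      show "(\<lambda>j. a \<odot>\<^bsub>M\<^esub> (c j \<odot>\<^bsub>M\<^esub> x j)) \<in> {..<k} \<rightarrow> carrier M" using a cx by auto
      fix j assume j: "j \<in> {..<k}"
      then have xj: "x j \<in> carrier M" using x by auto
      show "b j \<odot>\<^bsub>M\<^esub> x j = a \<odot>\<^bsub>M\<^esub> (c j \<odot>\<^bsub>M\<^esub> x j)"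
        using a xj c[OF j] bc[OF j] by (simp add: R.m_comm smult_assoc1)
    qed simp
    also have "\<dots> = a \<odot>\<^bsub>M\<^esub> (\<Oplus>\<^bsub>M\<^esub> j \<in> {..<k}. c j \<odot>\<^bsub>M\<^esub> x j)"
      using a cx by (simp add: finsum_smult_ldistr)
    finally show "y \<in> elem_mult a M"
      unfolding elem_mult_def using M.finsum_closed[OF cx] by blast
  qed
qed

text \<open>An ideal \<open>I\<close> that does not annihilate the module contains an element \<open>a\<close> that does not
  annihilate it, and \<open>I\<close> acts surjectively as soon as \<open>a\<close> does. Conversely, \<open>a\<close> acts as the
  principal ideal that it generates.\<close>

lemma (in module) second_iff_elem_mult:
  "second R M \<longleftrightarrow> nonzero_module M \<and>
    (\<forall>a\<in>carrier R. elem_mult a M = carrier M \<or> elem_mult a M = {\<zero>\<^bsub>M\<^esub>})"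
proof
  assume "second R M"
  then show "nonzero_module M \<and>
    (\<forall>a\<in>carrier R. elem_mult a M = carrier M \<or> elem_mult a M = {\<zero>\<^bsub>M\<^esub>})"
    unfolding second_def using ideal_mult_cgenideal cgenideal_ideal by metis
next
  assume R: "nonzero_module M \<and>
    (\<forall>a\<in>carrier R. elem_mult a M = carrier M \<or> elem_mult a M = {\<zero>\<^bsub>M\<^esub>})"
  have "ideal_mult I M = carrier M \<or> ideal_mult I M = {\<zero>\<^bsub>M\<^esub>}" if I: "ideal I R" for I
  proof (cases "\<forall>a\<in>I. elem_mult a M = {\<zero>\<^bsub>M\<^esub>}")
    case True
    then show ?thesis using ideal_mult_eq_zero_iff[OF I] by simp
  next
    case False
    then obtain a where a: "a \<in> I" and "elem_mult a M = carrier M"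
      using R ideal.Icarr[OF I] by blast
    then show ?thesis
      using elem_mult_subset_ideal_mult[OF I a] ideal_mult_subset_carrier[OF I] by blast
  qed
  then show "second R M" unfolding second_def using R module_axioms by blast
qed


section \<open>Surjective multiplications on Noetherian modules\<close>

lemma (in module) submodule_colon:
  assumes K: "submodule K R M" and L: "submodule L R M" and a: "a \<in> carrier R"
  shows "submodule {x \<in> K. a \<odot>\<^bsub>M\<^esub> x \<in> L} R M"
proof (rule submoduleI)
  note KE = submoduleE[OF K] and LE = submoduleE[OF L]
  have carr: "x \<in> carrier M" if "x \<in> K" for x using KE(1) that by blast
  show "{x \<in> K. a \<odot>\<^bsub>M\<^esub> x \<in> L} \<subseteq> carrier M" using carr by blast
  have "\<zero>\<^bsub>M\<^esub> \<in> N" if "submodule N R M" for N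
    using subgroup.one_closed[OF submodule.axioms(1)[OF that]] by simp
  then show "\<zero>\<^bsub>M\<^esub> \<in> {x \<in> K. a \<odot>\<^bsub>M\<^esub> x \<in> L}" using K L a by simp
  show "\<ominus>\<^bsub>M\<^esub> x \<in> {x \<in> K. a \<odot>\<^bsub>M\<^esub> x \<in> L}" if "x \<in> {x \<in> K. a \<odot>\<^bsub>M\<^esub> x \<in> L}" for x
    using that a carr KE(3) LE(3) by (auto simp: smult_r_minus)
  show "x \<oplus>\<^bsub>M\<^esub> y \<in> {x \<in> K. a \<odot>\<^bsub>M\<^esub> x \<in> L}"
    if "x \<in> {x \<in> K. a \<odot>\<^bsub>M\<^esub> x \<in> L}" "y \<in> {x \<in> K. a \<odot>\<^bsub>M\<^esub> x \<in> L}" for x y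
    using that a carr KE(5) LE(5) by (auto simp: smult_r_distr)
  show "r \<odot>\<^bsub>M\<^esub> x \<in> {x \<in> K. a \<odot>\<^bsub>M\<^esub> x \<in> L}"
    if r: "r \<in> carrier R" and x: "x \<in> {x \<in> K. a \<odot>\<^bsub>M\<^esub> x \<in> L}" for r x
  proof -
    have "a \<odot>\<^bsub>M\<^esub> (r \<odot>\<^bsub>M\<^esub> x) = r \<odot>\<^bsub>M\<^esub> (a \<odot>\<^bsub>M\<^esub> x)"
      using a r x carr R.m_comm[OF a r] by (simp flip: smult_assoc1)
    then show ?thesis using r x KE(4) LE(4) by auto
  qed
qed

text \<open>Choosing \<open>L = 0\<close> gives injectivity of \<open>a\<close> on \<open>K\<close>, choosing \<open>L \<subseteq> K\<close> gives
  surjectivity of \<open>a\<close> on \<open>L\<close>.\<close>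

lemma (in noetherian_module) mem_if_smult_mem:
  assumes K: "submodule K R M" and L: "submodule L R M" and a: "a \<in> carrier R"
    and onto: "elem_mult a (M\<lparr>carrier := K\<rparr>) = K"
    and y: "y \<in> K" and ay: "a \<odot>\<^bsub>M\<^esub> y \<in> L"
  shows "y \<in> L"
proof -
  interpret S: module R "M\<lparr>carrier := K\<rparr>"
    using K module_axioms by (rule submodule.submodule_is_module)
  define C where "C k = {x \<in> K. a [^] (k::nat) \<odot>\<^bsub>M\<^esub> x \<in> L}" for k
  have carr: "x \<in> carrier M" if "x \<in> K" for x using submoduleE(1)[OF K] that by blast
  have pow_Suc: "a [^] Suc k \<odot>\<^bsub>M\<^esub> x = a \<odot>\<^bsub>M\<^esub> (a [^] k \<odot>\<^bsub>M\<^esub> x)" if "x \<in> K" for x k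
    using a carr[OF that] R.m_comm[of a "a [^] k"] by (simp flip: smult_assoc1)
  have "\<exists>n. \<forall>m\<ge>n. C m = C n"
  proof (rule acc)
    show "submodule (C k) R M" for k
      unfolding C_def using K L a by (intro submodule_colon) auto
    show "C k \<subseteq> C (Suc k)" for k
      using a submoduleE(4)[OF L] pow_Suc[of _ k] unfolding C_def by (auto simp del: R.nat_pow_Suc)
  qed
  then obtain n where n: "C (Suc n) = C n" using le_SucI by blast
  obtain x where x: "x \<in> K" and yx: "y = a [^] n \<odot>\<^bsub>M\<^esub> x"
    using S.elem_mult_pow[OF a, of n] onto y by (auto simp: elem_mult_def)
  have "x \<in> C (Suc n)"
    using x ay yx pow_Suc[OF x, of n] unfolding C_def by (simp del: R.nat_pow_Suc)
  then show ?thesis using n yx unfolding C_def by blast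
qed

lemma (in noetherian_module) eq_zero_if_smult_eq_zero:
  assumes K: "submodule K R M" and a: "a \<in> carrier R"
    and onto: "elem_mult a (M\<lparr>carrier := K\<rparr>) = K"
    and y: "y \<in> K" and ay: "a \<odot>\<^bsub>M\<^esub> y = \<zero>\<^bsub>M\<^esub>"
  shows "y = \<zero>\<^bsub>M\<^esub>"
proof -
  have "submodule {\<zero>\<^bsub>M\<^esub>} R M" by (rule submoduleI) auto
  then show ?thesis using mem_if_smult_mem[OF K _ a onto y] ay by blast
qed

lemma (in noetherian_module) elem_mult_submodule_onto:
  assumes a: "a \<in> carrier R" and onto: "elem_mult a M = carrier M" and N: "submodule N R M"
  shows "elem_mult a (M\<lparr>carrier := N\<rparr>) = N"
proof
  show "elem_mult a (M\<lparr>carrier := N\<rparr>) \<subseteq> N"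
    using a submoduleE(4)[OF N] by (auto simp: elem_mult_def)
  show "N \<subseteq> elem_mult a (M\<lparr>carrier := N\<rparr>)"
  proof
    fix y assume y: "y \<in> N"
    then obtain z where z: "z \<in> carrier M" and yz: "y = a \<odot>\<^bsub>M\<^esub> z"
      using onto submoduleE(1)[OF N] unfolding elem_mult_def by blast
    have "z \<in> N"
      using mem_if_smult_mem[OF carrier_is_submodule N a] onto z y yz by simp
    then show "y \<in> elem_mult a (M\<lparr>carrier := N\<rparr>)"
      using yz by (simp add: elem_mult_def)
  qed
qed


section \<open>Passage to submodules\<close>

lemma (in module) elem_mult_submodule_zero:
  assumes N: "submodule N R M" and zero: "elem_mult a M = {\<zero>\<^bsub>M\<^esub>}"
  shows "elem_mult a (M\<lparr>carrier := N\<rparr>) = {\<zero>\<^bsub>M\<^esub>}"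
proof -
  interpret S: module R "M\<lparr>carrier := N\<rparr>"
    using N module_axioms by (rule submodule.submodule_is_module)
  show ?thesis
    using zero submoduleE(1)[OF N] S.elem_mult_eq_zero_iff[of a] elem_mult_eq_zero_iff[of a]
    by auto
qed

text \<open>An element acting surjectively on the whole module acts surjectively on \<open>N\<close> too, and so do
  its powers. Hence any nonzero submodule decides which of the two alternatives in the definition
  of secondary (or second) holds for the whole module.\<close>

lemma (in noetherian_module) not_onto_if_nilpotent_on_submodule:
  assumes a: "a \<in> carrier R" and N: "submodule N R M"
    and nz: "nonzero_module (M\<lparr>carrier := N\<rparr>)"
    and zero: "elem_mult (a [^] (n::nat)) (M\<lparr>carrier := N\<rparr>) = {\<zero>\<^bsub>M\<^esub>}"
  shows "elem_mult a M \<noteq> carrier M"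
proof
  interpret S: module R "M\<lparr>carrier := N\<rparr>"
    using N module_axioms by (rule submodule.submodule_is_module)
  assume "elem_mult a M = carrier M"
  then have "elem_mult a (M\<lparr>carrier := N\<rparr>) = N"
    using a N by (intro elem_mult_submodule_onto)
  then have "elem_mult (a [^] n) (M\<lparr>carrier := N\<rparr>) = N"
    using S.elem_mult_pow[OF a] by simp
  then show False using zero nz by (simp add: nonzero_module_def)
qed

lemma (in noetherian_module) p_secondary_submodule:
  assumes sec: "p_secondary R p M" and N: "submodule N R M"
    and nz: "nonzero_module (M\<lparr>carrier := N\<rparr>)"
  shows "p_secondary R p (M\<lparr>carrier := N\<rparr>)"
proof -
  let ?N = "M\<lparr>carrier := N\<rparr>"
  have dich: "elem_mult a M = carrier M \<or> (\<exists>n::nat. elem_mult (a [^] n) M = {\<zero>\<^bsub>M\<^esub>})"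
    if "a \<in> carrier R" for a
    using sec that unfolding p_secondary_def secondary_def by blast
  have "module R ?N" using N module_axioms by (rule submodule.submodule_is_module)
  moreover have "elem_mult a ?N = N \<or> (\<exists>n::nat. elem_mult (a [^] n) ?N = {\<zero>\<^bsub>M\<^esub>})"
    if "a \<in> carrier R" for a
    using dich[OF that] elem_mult_submodule_onto[OF that _ N] elem_mult_submodule_zero[OF N]
    by blast
  ultimately have "secondary R ?N" using nz unfolding secondary_def by simp
  moreover have "radical R (annihilator R M) = radical R (annihilator R ?N)"
  proof (rule Set.set_eqI)
    fix a
    have "(\<exists>n::nat. elem_mult (a [^] n) M = {\<zero>\<^bsub>M\<^esub>}) \<longleftrightarrow>
        (\<exists>n::nat. elem_mult (a [^] n) ?N = {\<zero>\<^bsub>M\<^esub>})" if a: "a \<in> carrier R"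
      using elem_mult_submodule_zero[OF N] dich[OF a]
        not_onto_if_nilpotent_on_submodule[OF a N nz] by metis
    then show "a \<in> radical R (annihilator R M) \<longleftrightarrow> a \<in> radical R (annihilator R ?N)"
      by (auto simp: radical_annihilator_iff[OF R.is_cring])
  qed
  ultimately show ?thesis using sec unfolding p_secondary_def by simp
qed

lemma (in noetherian_module) p_second_submodule:
  assumes sec: "p_second R p M" and N: "submodule N R M"
    and nz: "nonzero_module (M\<lparr>carrier := N\<rparr>)"
  shows "p_second R p (M\<lparr>carrier := N\<rparr>)"
proof -
  let ?N = "M\<lparr>carrier := N\<rparr>"
  interpret S: module R ?N
    using N module_axioms by (rule submodule.submodule_is_module)
  have dich: "elem_mult a M = carrier M \<or> elem_mult a M = {\<zero>\<^bsub>M\<^esub>}" if "a \<in> carrier R" for a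
    using sec that unfolding p_second_def second_iff_elem_mult by blast
  have "elem_mult a ?N = N \<or> elem_mult a ?N = {\<zero>\<^bsub>M\<^esub>}" if "a \<in> carrier R" for a
    using dich[OF that] elem_mult_submodule_onto[OF that _ N] elem_mult_submodule_zero[OF N]
    by blast
  then have "second R ?N" using nz unfolding S.second_iff_elem_mult by simp
  moreover have "annihilator R M = annihilator R ?N"
  proof (rule Set.set_eqI)
    fix a
    have "elem_mult a M = {\<zero>\<^bsub>M\<^esub>}" if a: "a \<in> carrier R" and zero: "elem_mult a ?N = {\<zero>\<^bsub>M\<^esub>}"
      using dich[OF a] not_onto_if_nilpotent_on_submodule[OF a N nz, of 1] a zero by simp
    then show "a \<in> annihilator R M \<longleftrightarrow> a \<in> annihilator R ?N"
      using elem_mult_submodule_zero[OF N] unfolding annihilator_def by auto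
  qed
  ultimately show ?thesis using sec unfolding p_second_def by simp
qed


section \<open>Independence of secondary submodules\<close>

text \<open>Since \<open>a\<close> lies in the radical for \<open>K\<close>, one of its powers kills \<open>K\<close>. Since it lies
  outside the radical for the secondary submodule \<open>L\<close>, it acts surjectively on \<open>L\<close>; so does
  that power, which is then injective on \<open>L\<close> by the chain condition.\<close>

lemma (in noetherian_module) secondary_separating_element:
  assumes K: "submodule K R M"
    and L: "submodule L R M" "secondary R (M\<lparr>carrier := L\<rparr>)"
    and a: "a \<in> radical R (annihilator R (M\<lparr>carrier := K\<rparr>))"
      "a \<notin> radical R (annihilator R (M\<lparr>carrier := L\<rparr>))"
  obtains b where "b \<in> carrier R" "\<And>x. x \<in> K \<Longrightarrow> b \<odot>\<^bsub>M\<^esub> x = \<zero>\<^bsub>M\<^esub>"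
    "\<And>x. \<lbrakk>x \<in> L; b \<odot>\<^bsub>M\<^esub> x = \<zero>\<^bsub>M\<^esub>\<rbrakk> \<Longrightarrow> x = \<zero>\<^bsub>M\<^esub>"
proof -
  interpret K: module R "M\<lparr>carrier := K\<rparr>"
    using K module_axioms by (rule submodule.submodule_is_module)
  interpret L: module R "M\<lparr>carrier := L\<rparr>"
    using L(1) module_axioms by (rule submodule.submodule_is_module)
  obtain n :: nat where aR: "a \<in> carrier R"
    and n: "elem_mult (a [^] n) (M\<lparr>carrier := K\<rparr>) = {\<zero>\<^bsub>M\<^esub>}"
    using a(1) by (auto simp: radical_annihilator_iff[OF R.is_cring])
  have "elem_mult a (M\<lparr>carrier := L\<rparr>) = L"
    using a(2) L(2) aR by (auto simp: radical_annihilator_iff[OF R.is_cring] secondary_def)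
  then have "elem_mult (a [^] n) (M\<lparr>carrier := L\<rparr>) = L"
    using L.elem_mult_pow[OF aR] by simp
  then have "x = \<zero>\<^bsub>M\<^esub>" if "x \<in> L" "a [^] n \<odot>\<^bsub>M\<^esub> x = \<zero>\<^bsub>M\<^esub>" for x
    using eq_zero_if_smult_eq_zero[OF L(1) R.nat_pow_closed[OF aR]] that by blast
  moreover have "a [^] n \<odot>\<^bsub>M\<^esub> x = \<zero>\<^bsub>M\<^esub>" if "x \<in> K" for x
    using n that K.elem_mult_eq_zero_iff by simp
  ultimately show thesis using that[of "a [^] n"] aR by blast
qed

lemma (in module) finsum_remove_zero:
  assumes "finite J" "i \<in> J" "f \<in> J \<rightarrow> carrier M" "f i = \<zero>\<^bsub>M\<^esub>"
  shows "(\<Oplus>\<^bsub>M\<^esub> k \<in> J. f k) = (\<Oplus>\<^bsub>M\<^esub> k \<in> J - {i}. f k)"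
proof -
  have "(\<Oplus>\<^bsub>M\<^esub> k \<in> insert i (J - {i}). f k) = f i \<oplus>\<^bsub>M\<^esub> (\<Oplus>\<^bsub>M\<^esub> k \<in> J - {i}. f k)"
    using assms by (intro M.finsum_insert) auto
  moreover have "(\<Oplus>\<^bsub>M\<^esub> k \<in> J - {i}. f k) \<in> carrier M"
    using assms by (intro M.finsum_closed) auto
  ultimately show ?thesis using assms by (simp add: insert_absorb)
qed

text \<open>The separating element yields a relation with one term fewer, and its vanishing removes
  another term from the given relation. The submodules never change, only the set of indices
  shrinks, and so the induction is on that set with the family \<open>x\<close> arbitrary.\<close>

lemma (in noetherian_module) secondary_independent:
  assumes fin: "finite J"
    and sub: "\<And>i. i \<in> J \<Longrightarrow> submodule (K i) R M"
    and sec: "\<And>i. i \<in> J \<Longrightarrow> secondary R (M\<lparr>carrier := K i\<rparr>)"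
    and dist: "\<And>i j. \<lbrakk>i \<in> J; j \<in> J; i \<noteq> j\<rbrakk> \<Longrightarrow>
      radical R (annihilator R (M\<lparr>carrier := K i\<rparr>)) \<noteq> radical R (annihilator R (M\<lparr>carrier := K j\<rparr>))"
    and x: "\<And>i. i \<in> J \<Longrightarrow> x i \<in> K i"
    and sum: "(\<Oplus>\<^bsub>M\<^esub> i \<in> J. x i) = \<zero>\<^bsub>M\<^esub>"
  shows "\<forall>i\<in>J. x i = \<zero>\<^bsub>M\<^esub>"
  using assms
proof (induction J arbitrary: x rule: finite_psubset_induct)
  case (psubset J)
  note fin = psubset.hyps and sub = psubset.prems(1) and sec = psubset.prems(2)
    and dist = psubset.prems(3) and x = psubset.prems(4) and sum = psubset.prems(5)
  have smaller: "\<forall>k\<in>J - {i}. y k = \<zero>\<^bsub>M\<^esub>"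
    if "i \<in> J" "\<And>k. k \<in> J \<Longrightarrow> y k \<in> K k" "(\<Oplus>\<^bsub>M\<^esub> k \<in> J - {i}. y k) = \<zero>\<^bsub>M\<^esub>" for i y
    by (rule psubset.IH) (use that sub sec dist in auto)
  have carr: "y \<in> carrier M" if "y \<in> K k" "k \<in> J" for y k
    using submoduleE(1)[OF sub] that by blast
  have xM: "x \<in> J \<rightarrow> carrier M" using x carr by auto
  show ?case
  proof (cases "\<exists>i j. i \<in> J \<and> j \<in> J \<and> i \<noteq> j")
    case True
    then obtain i' j' where ij': "i' \<in> J" "j' \<in> J" "i' \<noteq> j'" by blast
    \<comment> \<open>One of the two primes has an element outside the other; let \<open>i\<close> be its index.\<close>
    obtain i j a where ij: "i \<in> J" "j \<in> J" "i \<noteq> j"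
      and a: "a \<in> radical R (annihilator R (M\<lparr>carrier := K i\<rparr>))"
        "a \<notin> radical R (annihilator R (M\<lparr>carrier := K j\<rparr>))"
      using dist[OF ij'] ij' by (auto simp: set_eq_iff)
    obtain b where b: "b \<in> carrier R" and kill: "\<And>x. x \<in> K i \<Longrightarrow> b \<odot>\<^bsub>M\<^esub> x = \<zero>\<^bsub>M\<^esub>"
      and inj: "\<And>x. \<lbrakk>x \<in> K j; b \<odot>\<^bsub>M\<^esub> x = \<zero>\<^bsub>M\<^esub>\<rbrakk> \<Longrightarrow> x = \<zero>\<^bsub>M\<^esub>"
      using secondary_separating_element[OF sub sub sec a] ij by blast
    have "(\<Oplus>\<^bsub>M\<^esub> k \<in> J - {i}. b \<odot>\<^bsub>M\<^esub> x k) = (\<Oplus>\<^bsub>M\<^esub> k \<in> J. b \<odot>\<^bsub>M\<^esub> x k)"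
      using fin ij xM b kill x by (intro finsum_remove_zero[symmetric]) auto
    also have "\<dots> = b \<odot>\<^bsub>M\<^esub> (\<Oplus>\<^bsub>M\<^esub> k \<in> J. x k)"
      using fin b xM by (simp add: finsum_smult_ldistr)
    finally have "\<forall>k\<in>J - {i}. b \<odot>\<^bsub>M\<^esub> x k = \<zero>\<^bsub>M\<^esub>"
      using ij b x sum submoduleE(4)[OF sub] by (intro smaller) auto
    then have xj: "x j = \<zero>\<^bsub>M\<^esub>" using inj x ij by blast
    then have "\<forall>k\<in>J - {j}. x k = \<zero>\<^bsub>M\<^esub>"
      using ij x sum finsum_remove_zero[OF fin ij(2) xM] by (intro smaller) auto
    then show ?thesis using xj by blast
  next
    case False
    show ?thesis
    proof
      fix i assume i: "i \<in> J"
      then have "J = {i}" using False by blast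
      then show "x i = \<zero>\<^bsub>M\<^esub>" using sum xM by simp
    qed
  qed
qed

lemma (in module) finsum_eq_imp_finsum_diff_eq_zero:
  assumes fin: "finite J" and x: "x \<in> J \<rightarrow> carrier M" and y: "y \<in> J \<rightarrow> carrier M"
    and eq: "(\<Oplus>\<^bsub>M\<^esub> i \<in> J. x i) = (\<Oplus>\<^bsub>M\<^esub> i \<in> J. y i)"
  shows "(\<Oplus>\<^bsub>M\<^esub> i \<in> J. x i \<ominus>\<^bsub>M\<^esub> y i) = \<zero>\<^bsub>M\<^esub>"
proof -
  have yi: "y i \<in> carrier M" if "i \<in> J" for i using y that by auto
  have neg: "(\<lambda>i. \<ominus>\<^bsub>M\<^esub> y i) \<in> J \<rightarrow> carrier M" using yi by auto
  have sums: "(\<Oplus>\<^bsub>M\<^esub> i \<in> J. z i \<ominus>\<^bsub>M\<^esub> y i) =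
      (\<Oplus>\<^bsub>M\<^esub> i \<in> J. z i) \<oplus>\<^bsub>M\<^esub> (\<Oplus>\<^bsub>M\<^esub> i \<in> J. \<ominus>\<^bsub>M\<^esub> y i)" if "z \<in> J \<rightarrow> carrier M" for z
    unfolding a_minus_def using that neg by (rule M.finsum_addf)
  have "(\<Oplus>\<^bsub>M\<^esub> i \<in> J. x i \<ominus>\<^bsub>M\<^esub> y i) = (\<Oplus>\<^bsub>M\<^esub> i \<in> J. y i \<ominus>\<^bsub>M\<^esub> y i)"
    using sums x y eq by simp
  also have "\<dots> = \<zero>\<^bsub>M\<^esub>"
    by (rule M.add.finprod_one_eqI) (simp add: yi a_minus_def M.r_neg)
  finally show ?thesis .
qed

lemma (in noetherian_module) minimal_secondary_representation_direct:
  assumes rep: "minimal_secondary_representation R M n K"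
  shows "is_direct_sum R M K {1..n}"
proof -
  have sub: "submodule (K i) R M" and sec: "secondary R (M\<lparr>carrier := K i\<rparr>)"
    if "i \<in> {1..n}" for i
    using rep that unfolding minimal_secondary_representation_def secondary_representation_def
    by blast+
  have dist: "radical R (annihilator R (M\<lparr>carrier := K i\<rparr>))
      \<noteq> radical R (annihilator R (M\<lparr>carrier := K j\<rparr>))"
    if "i \<in> {1..n}" "j \<in> {1..n}" "i \<noteq> j" for i j
    using rep that unfolding minimal_secondary_representation_def by blast
  have sum: "carrier M = submodule_sum M K {1..n}"
    using rep unfolding minimal_secondary_representation_def secondary_representation_def by blast
  have carr: "x i \<in> carrier M" if "x \<in> (\<Pi>\<^sub>E i\<in>{1..n}. K i)" "i \<in> {1..n}" for x i
    using submoduleE(1)[OF sub] that by blast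
  have "\<exists>!x. x \<in> (\<Pi>\<^sub>E i\<in>{1..n}. K i) \<and> m = (\<Oplus>\<^bsub>M\<^esub> i \<in> {1..n}. x i)"
    if m: "m \<in> carrier M" for m
  proof (rule ex_ex1I)
    obtain x where x: "\<forall>i\<in>{1..n}. x i \<in> K i" and mx: "m = (\<Oplus>\<^bsub>M\<^esub> i \<in> {1..n}. x i)"
      using m unfolding sum submodule_sum_def by blast
    have "(\<Oplus>\<^bsub>M\<^esub> i \<in> {1..n}. x i) = (\<Oplus>\<^bsub>M\<^esub> i \<in> {1..n}. restrict x {1..n} i)"
      using x submoduleE(1)[OF sub] by (intro M.finsum_cong') (simp, blast, simp)
    then show "\<exists>x. x \<in> (\<Pi>\<^sub>E i\<in>{1..n}. K i) \<and> m = (\<Oplus>\<^bsub>M\<^esub> i \<in> {1..n}. x i)"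
      using x mx by (intro exI[of _ "restrict x {1..n}"]) auto
  next
    fix x y
    assume x: "x \<in> (\<Pi>\<^sub>E i\<in>{1..n}. K i) \<and> m = (\<Oplus>\<^bsub>M\<^esub> i \<in> {1..n}. x i)"
      and y: "y \<in> (\<Pi>\<^sub>E i\<in>{1..n}. K i) \<and> m = (\<Oplus>\<^bsub>M\<^esub> i \<in> {1..n}. y i)"
    have diff: "\<forall>i\<in>{1..n}. x i \<ominus>\<^bsub>M\<^esub> y i = \<zero>\<^bsub>M\<^esub>"
    proof (rule secondary_independent[where K = K])
      show "x i \<ominus>\<^bsub>M\<^esub> y i \<in> K i" if i: "i \<in> {1..n}" for i
        unfolding a_minus_def using x y i submoduleE(3,5)[OF sub[OF i]] by blast
      show "(\<Oplus>\<^bsub>M\<^esub> i \<in> {1..n}. x i \<ominus>\<^bsub>M\<^esub> y i) = \<zero>\<^bsub>M\<^esub>"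
        using x y carr by (intro finsum_eq_imp_finsum_diff_eq_zero) auto
    qed (use sub sec dist in auto)
    show "x = y"
    proof (rule PiE_ext[OF conjunct1[OF x] conjunct1[OF y]])
      show "x i = y i" if i: "i \<in> {1..n}" for i
      proof -
        have xi: "x i \<in> carrier M" and yi: "y i \<in> carrier M" using carr x y i by blast+
        have "x i \<oplus>\<^bsub>M\<^esub> \<ominus>\<^bsub>M\<^esub> y i = \<zero>\<^bsub>M\<^esub>" using diff i by (simp add: a_minus_def)
        then have "\<ominus>\<^bsub>M\<^esub> (\<ominus>\<^bsub>M\<^esub> y i) = x i" using xi yi by (intro M.minus_equality) auto
        then show ?thesis using yi by (simp add: M.minus_minus)
      qed
    qed
  qed
  then show ?thesis unfolding is_direct_sum_def using sub sum by simp
qed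


section \<open>Secondary and second Noetherian modules\<close>

theorem theorem3p6:
  fixes R :: "('a, 'r) ring_scheme" and M :: "('a, 'b, 'm) module_scheme"
  assumes "noetherian_module R M" and "nonzero_module M"
  shows "(\<forall>p. primeideal p R \<longrightarrow>
            (p_secondary R p M \<longleftrightarrow>
              (\<forall>N. submodule N R M \<and> nonzero_module (M\<lparr>carrier := N\<rparr>) \<longrightarrow>
                 p_secondary R p (M\<lparr>carrier := N\<rparr>))) \<and>
            (p_second R p M \<longleftrightarrow>
              (\<forall>N. submodule N R M \<and> nonzero_module (M\<lparr>carrier := N\<rparr>) \<longrightarrow>
                 p_second R p (M\<lparr>carrier := N\<rparr>)))) \<and>
         (\<forall>n K p. minimal_secondary_representation R M n K \<and>
            (\<forall>i\<in>{1..n}. primeideal (p i) R \<and> p_secondary R (p i) (M\<lparr>carrier := K i\<rparr>)) \<longrightarrow>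
            is_direct_sum R M K {1..n})"
proof -
  interpret noetherian_module R M by fact
  have "Q M" if "\<forall>N. submodule N R M \<and> nonzero_module (M\<lparr>carrier := N\<rparr>) \<longrightarrow> Q (M\<lparr>carrier := N\<rparr>)"
    for Q
    using that[rule_format, of "carrier M"] carrier_is_submodule assms(2) by simp
  from this[of "p_secondary R p" for p] this[of "p_second R p" for p]
  show ?thesis
    using p_secondary_submodule p_second_submodule minimal_secondary_representation_direct
    by blast
qed

end
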